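(* Algorithm A (described in the context) is an exact separation algorithm for the first complementarity pack inequalities: given an instance of the complementarity knapsack problem and a point $x^*\in[0,1]^d$ that satisfies the knapsack constraint $\sum_{ij\in I}a_{ij}x^*_{ij}\le b$ and the clique inequalities $\sum_{j\in N_i}x^*_{ij}\le 1$ for all $i\in M$, but violates some complementarity constraint, Algorithm A returns a pack $P$ whose first complementarity pack inequality is violated by $x^*$ whenever such a pack exists (and returns no pack otherwise).
   Context: Let $M=\{1,\dots,m\}$, $N_i=\{1,\dots,n_i\}$ for $i\in M$, $I=\{(i,j)\mid i\in M, j\in N_i\}$ (the pair $(i,j)$ is also written $ij$), $d=\sum_{i\in M} n_i$, and let $b\in\mathbb{R}_+$, $a_{ij}\in\mathbb{R}_+$ for $ij\in I$. The feasible points of the complementarity knapsack problem are the $x\in[0,1]^d$ satisfying the knapsack constraint $\sum_{ij\in I}a_{ij}x_{ij}\le b$ and the complementarity constraints $x_{ij}\cdot x_{ij'}=0$ for all $i\in M$, $j\ne j'\in N_i$. Let $M_0=\{i\in M\mid n_i=1\}$. Standing assumptions: $M\ne M_0$; $\sum_{i\in M}\max\{a_{i1},\dots,a_{in_i}\}>b$; $b>0$ and $a_{ij}\ge 0$ for all $ij\in I$; $a_{i1}\ge\dots\ge a_{in_i}$ for all $i\in M\setminus M_0$. For $T\subseteq I$, $M_T=\{i\in M\mid ij\in T\text{ for some } j\in N_i\}$. A pack is a set $P=\{i_1j_1,\dots,i_kj_k\}\subset I$ with $i_1,\dots,i_k$ all distinct and $\sum_{ij\in P}a_{ij}<b$.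 With $s=\sum_{ij\in P}a_{ij}$, the first complementarity pack inequality of $P$ is $$\sum_{i \in M_P} \sum_{j \in N_i} a_{ij} x_{ij} + \sum_{ij \in P,\; i \in M_P \setminus M_0} (b-s)\, x_{ij} \leq b + (|M_P \setminus M_0| - 1) (b-s).$$ Algorithm A. For each $i\in M\setminus M_0$ fix an ordering $o_{i,1},\dots,o_{i,n_i}$ of $N_i$ with $x^*_{i,o_{i,1}}\ge x^*_{i,o_{i,2}}\ge\dots\ge x^*_{i,o_{i,n_i}}$. For every $\bar M\subseteq\{i\in M\setminus M_0\mid x^*_{i,o_{i,1}}>0\}$: if $\sum_{i\in\bar M}(1-x^*_{i,o_{i,1}})\ge 1$, go on to the next $\bar M$. Otherwise, for every $i'\in\bar M$ and for $j'=o_{i',1},o_{i',2},\dots,o_{i',n_{i'}}$ in this order: set $\bar P:=\{(i',j')\}\cup\{(i,o_{i,1})\mid i\in\bar M\setminus\{i'\}\}$; if $\sum_{ij\in\bar P}(1-x^*_{ij})\ge1$, break out of the loop over $j'$; else if $\bar P$ is not a pack, go on to the next $j'$; else, for every $P_0\subseteq\{(i,1)\mid i\in M_0,\ x^*_{i1}>1-\sum_{kl\in\bar P}(1-x^*_{kl})\}$, set $P:=\bar P\cup P_0$ and, if $P$ is a pack and $x^*$ violates the first complementarity pack inequality of $P$, return $P$ and stop. *)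

theory Defs
  imports Complex_Main
begin

record ckp =
  groups :: nat
  size_of :: "nat \<Rightarrow> nat"
  weight :: "nat \<times> nat \<Rightarrow> real"
  capacity :: real

definition M_set :: "ckp \<Rightarrow> nat set" where
  "M_set K = {1..groups K}"

definition N_set :: "ckp \<Rightarrow> nat \<Rightarrow> nat set" where
  "N_set K i = {1..size_of K i}"

definition I_set :: "ckp \<Rightarrow> (nat \<times> nat) set" where
  "I_set K = (SIGMA i:M_set K. N_set K i)"

definition M0_set :: "ckp \<Rightarrow> nat set" where
  "M0_set K = {i \<in> M_set K. size_of K i = 1}"

text \<open>The condition that every group is nonempty is what makes the maxima below meaningful.\<close>

definition ckp_instance :: "ckp \<Rightarrow> bool" where
  "ckp_instance K \<longleftrightarrow>
     (\<forall>i\<in>M_set K. 1 \<le> size_of K i) \<and>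
     M_set K \<noteq> M0_set K \<and>
     (\<Sum>i\<in>M_set K. Max ((\<lambda>j. weight K (i, j)) ` N_set K i)) > capacity K \<and>
     capacity K > 0 \<and>
     (\<forall>ij\<in>I_set K. weight K ij \<ge> 0) \<and>
     (\<forall>i\<in>M_set K - M0_set K. \<forall>j\<in>N_set K i. \<forall>j'\<in>N_set K i.
        j \<le> j' \<longrightarrow> weight K (i, j) \<ge> weight K (i, j'))"

text \<open>
  A point of $[0,1]^d$ is a function on index pairs, of which only the values on
  \<^term>\<open>I_set K\<close> matter.
\<close>

definition in_unit_box :: "ckp \<Rightarrow> (nat \<times> nat \<Rightarrow> real) \<Rightarrow> bool" where
  "in_unit_box K x \<longleftrightarrow> (\<forall>ij\<in>I_set K. 0 \<le> x ij \<and> x ij \<le> 1)"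

definition knapsack_constraint :: "ckp \<Rightarrow> (nat \<times> nat \<Rightarrow> real) \<Rightarrow> bool" where
  "knapsack_constraint K x \<longleftrightarrow> (\<Sum>ij\<in>I_set K. weight K ij * x ij) \<le> capacity K"

definition clique_inequalities :: "ckp \<Rightarrow> (nat \<times> nat \<Rightarrow> real) \<Rightarrow> bool" where
  "clique_inequalities K x \<longleftrightarrow> (\<forall>i\<in>M_set K. (\<Sum>j\<in>N_set K i. x (i, j)) \<le> 1)"

definition complementarity_constraints :: "ckp \<Rightarrow> (nat \<times> nat \<Rightarrow> real) \<Rightarrow> bool" where
  "complementarity_constraints K x \<longleftrightarrow>
     (\<forall>i\<in>M_set K. \<forall>j\<in>N_set K i. \<forall>j'\<in>N_set K i. j \<noteq> j' \<longrightarrow> x (i, j) * x (i, j') = 0)"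

definition M_of :: "ckp \<Rightarrow> (nat \<times> nat) set \<Rightarrow> nat set" where
  "M_of K T = {i \<in> M_set K. \<exists>j\<in>N_set K i. (i, j) \<in> T}"

definition pack_weight :: "ckp \<Rightarrow> (nat \<times> nat) set \<Rightarrow> real" where
  "pack_weight K P = (\<Sum>ij\<in>P. weight K ij)"

definition pack :: "ckp \<Rightarrow> (nat \<times> nat) set \<Rightarrow> bool" where
  "pack K P \<longleftrightarrow> P \<subseteq> I_set K \<and> inj_on fst P \<and> pack_weight K P < capacity K"

definition first_pack_ineq :: "ckp \<Rightarrow> (nat \<times> nat) set \<Rightarrow> (nat \<times> nat \<Rightarrow> real) \<Rightarrow> bool" where
  "first_pack_ineq K P x \<longleftrightarrow>
     (let b = capacity K; s = pack_weight K P; L = M_of K P - M0_set K in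
        (\<Sum>i\<in>M_of K P. \<Sum>j\<in>N_set K i. weight K (i, j) * x (i, j))
          + (\<Sum>ij\<in>{ij \<in> P. fst ij \<in> L}. (b - s) * x ij)
        \<le> b + (real (card L) - 1) * (b - s))"

text \<open>
  The algorithm is a nest of loops over lists. A loop body proceeds to the next element, breaks
  out of its own loop, or returns a value from the whole algorithm; the result
  \<^term>\<open>None\<close> of a loop means that it was left without returning.
\<close>

datatype 'r outcome = Next | Break | Return 'r

fun for_loop :: "'a list \<Rightarrow> ('a \<Rightarrow> 'r outcome) \<Rightarrow> 'r option" where
  "for_loop [] body = None"
| "for_loop (y # ys) body =
     (case body y of Next \<Rightarrow> for_loop ys body | Break \<Rightarrow> None | Return r \<Rightarrow> Some r)"

fun inner_loop :: "'r option \<Rightarrow> 'r outcome" where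
  "inner_loop None = Next"
| "inner_loop (Some r) = Return r"

text \<open>
  The list \<open>ord i\<close> is the ordering $o_{i,1},\dots,o_{i,n_i}$, with ties broken arbitrarily.
\<close>

definition valid_orderings :: "ckp \<Rightarrow> (nat \<times> nat \<Rightarrow> real) \<Rightarrow> (nat \<Rightarrow> nat list) \<Rightarrow> bool" where
  "valid_orderings K x ord \<longleftrightarrow>
     (\<forall>i\<in>M_set K - M0_set K. distinct (ord i) \<and> set (ord i) = N_set K i \<and>
        sorted_wrt (\<lambda>j j'. x (i, j) \<ge> x (i, j')) (ord i))"

definition active_groups :: "ckp \<Rightarrow> (nat \<times> nat \<Rightarrow> real) \<Rightarrow> (nat \<Rightarrow> nat list) \<Rightarrow> nat set" where
  "active_groups K x ord = {i \<in> M_set K - M0_set K. x (i, hd (ord i)) > 0}"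

definition base_set :: "(nat \<Rightarrow> nat list) \<Rightarrow> nat set \<Rightarrow> nat \<Rightarrow> nat \<Rightarrow> (nat \<times> nat) set" where
  "base_set ord Mb i' j' = {(i', j')} \<union> (\<lambda>i. (i, hd (ord i))) ` (Mb - {i'})"

definition extension_candidates ::
  "ckp \<Rightarrow> (nat \<times> nat \<Rightarrow> real) \<Rightarrow> (nat \<times> nat) set \<Rightarrow> (nat \<times> nat) set" where
  "extension_candidates K x Pb =
     {(i, 1) | i. i \<in> M0_set K \<and> x (i, 1) > 1 - (\<Sum>kl\<in>Pb. 1 - x kl)}"

text \<open>
  The order in which the ``for every'' loops run through their ranges is left open, so it is a
  parameter: \<open>eM\<close> lists the sets $\bar M$, \<open>eI\<close> lists the $i'$ for given $\bar M$, and
  \<open>eP\<close> lists the sets $P_0$ for given $\bar M$, $i'$, $j'$.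
\<close>

definition enumerates :: "'a list \<Rightarrow> 'a set \<Rightarrow> bool" where
  "enumerates xs A \<longleftrightarrow> distinct xs \<and> set xs = A"

definition valid_enumerations ::
  "ckp \<Rightarrow> (nat \<times> nat \<Rightarrow> real) \<Rightarrow> (nat \<Rightarrow> nat list) \<Rightarrow> nat set list \<Rightarrow> (nat set \<Rightarrow> nat list) \<Rightarrow>
   (nat set \<Rightarrow> nat \<Rightarrow> nat \<Rightarrow> (nat \<times> nat) set list) \<Rightarrow> bool" where
  "valid_enumerations K x ord eM eI eP \<longleftrightarrow>
     enumerates eM (Pow (active_groups K x ord)) \<and>
     (\<forall>Mb \<subseteq> active_groups K x ord. enumerates (eI Mb) Mb \<and>
        (\<forall>i'\<in>Mb. \<forall>j'\<in>N_set K i'.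
           enumerates (eP Mb i' j') (Pow (extension_candidates K x (base_set ord Mb i' j')))))"

definition algorithm_A ::
  "ckp \<Rightarrow> (nat \<times> nat \<Rightarrow> real) \<Rightarrow> (nat \<Rightarrow> nat list) \<Rightarrow> nat set list \<Rightarrow> (nat set \<Rightarrow> nat list) \<Rightarrow>
   (nat set \<Rightarrow> nat \<Rightarrow> nat \<Rightarrow> (nat \<times> nat) set list) \<Rightarrow> (nat \<times> nat) set option" where
  "algorithm_A K x ord eM eI eP =
     for_loop eM (\<lambda>Mb.
       if (\<Sum>i\<in>Mb. 1 - x (i, hd (ord i))) \<ge> 1 then Next
       else inner_loop (for_loop (eI Mb) (\<lambda>i'.
         inner_loop (for_loop (ord i') (\<lambda>j'.
           let Pb = base_set ord Mb i' j' in
           if (\<Sum>ij\<in>Pb. 1 - x ij) \<ge> 1 then Break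
           else if \<not> pack K Pb then Next
           else inner_loop (for_loop (eP Mb i' j') (\<lambda>P0.
             let P = Pb \<union> P0 in
             if pack K P \<and> \<not> first_pack_ineq K P x then Return P else Next)))))))"

end

theory Submission
  imports Defs
begin

text \<open>
  With \<open>D = 1 - (\<Sum>ij\<in>P, i \<notin> M0. 1 - x ij)\<close>, the inequality of a pack \<open>P\<close> of weight \<open>s\<close> reads
  \<open>(\<Sum>i\<in>M_P. \<Sum>j. a ij * x ij) + (b - s) * D \<le> b\<close>. As the first sum is at most \<open>b\<close> by the knapsack
  constraint, a violation forces \<open>D > 0\<close>. By the clique inequalities, \<open>x ij \<le> 1/2\<close> unless \<open>j\<close> is
  the first index of the ordering of its group, so \<open>D > 0\<close> allows at most one such pair outside
  the trivial groups: these pairs form one of the sets that the algorithm inspects. Removing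
  a pair \<open>(i, 1)\<close> of a trivial group changes the left-hand side by \<open>a (i, 1) * (D - x (i, 1))\<close>, so all
  pairs with \<open>x (i, 1) \<le> D\<close> may be dropped from a violated pack.
\<close>

section \<open>Loops that return or break\<close>

lemma for_loop_SomeD:
  "for_loop xs body = Some r \<Longrightarrow> \<exists>y\<in>set xs. body y = Return r"
  by (induction xs) (auto split: outcome.splits)

text \<open>Iterations over \<open>ys\<close> may return a value of their own, so only the existence
  of a result is claimed. A \<open>Break\<close> ahead of \<open>y\<close> is the only way to miss
  \<open>y\<close> without returning.\<close>

lemma for_loop_returns:
  assumes "body y = Return r" and "\<forall>z\<in>set ys. body z \<noteq> Break"
  shows "\<exists>r. for_loop (ys @ y # zs) body = Some r"
  using assms by (induction ys) (auto split: outcome.splits)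

lemma for_loop_returns_no_break:
  assumes "y \<in> set xs" and "body y = Return r" and "\<And>z. body z \<noteq> Break"
  shows "\<exists>r. for_loop xs body = Some r"
  using assms for_loop_returns[of body y r] by (metis split_list)

lemma inner_loop_neq_Break [simp]: "inner_loop r \<noteq> Break"
  by (cases r) auto

lemma inner_loop_Return_iff [simp]: "inner_loop q = Return r \<longleftrightarrow> q = Some r"
  by (cases q) auto

lemma finite_I_set [simp]: "finite (I_set K)"
  by (auto simp: I_set_def M_set_def N_set_def)

section \<open>The pack inequality in terms of the nontrivial part\<close>

definition nontrivial_part :: "ckp \<Rightarrow> (nat \<times> nat) set \<Rightarrow> (nat \<times> nat) set" where
  "nontrivial_part K P = {ij \<in> P. fst ij \<notin> M0_set K}"

definition group_load :: "ckp \<Rightarrow> (nat \<times> nat \<Rightarrow> real) \<Rightarrow> nat \<Rightarrow> real" where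
  "group_load K x i = (\<Sum>j\<in>N_set K i. weight K (i, j) * x (i, j))"

lemma pack_finite: "pack K P \<Longrightarrow> finite P"
  unfolding pack_def using finite_I_set finite_subset by blast

lemma M_of_eq_image: "P \<subseteq> I_set K \<Longrightarrow> M_of K P = fst ` P"
  by (force simp: M_of_def I_set_def)

text \<open>For k nontrivial pairs, the sum of their \<open>x ij\<close> minus \<open>k - 1\<close>
  is one minus the sum of the terms \<open>1 - x ij\<close>. As \<open>fst\<close> is injective on a
  pack, sums over groups become sums over pairs.\<close>

lemma first_pack_ineq_alt:
  assumes "pack K P"
  shows "first_pack_ineq K P x \<longleftrightarrow>
    (\<Sum>ij\<in>P. group_load K x (fst ij))
      + (capacity K - pack_weight K P) * (1 - (\<Sum>ij\<in>nontrivial_part K P. 1 - x ij)) \<le> capacity K"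
proof -
  let ?Q = "nontrivial_part K P" and ?r = "capacity K - pack_weight K P"
  have sub: "P \<subseteq> I_set K" and inj: "inj_on fst P" using assms by (auto simp: pack_def)
  have M: "M_of K P = fst ` P" by (rule M_of_eq_image[OF sub])
  have Q: "{ij \<in> P. fst ij \<in> M_of K P - M0_set K} = ?Q"
    by (auto simp: M nontrivial_part_def)
  have "M_of K P - M0_set K = fst ` ?Q" by (auto simp: M nontrivial_part_def)
  moreover have "inj_on fst ?Q" using inj by (auto simp: nontrivial_part_def inj_on_def)
  ultimately have c: "card (M_of K P - M0_set K) = card ?Q" by (simp add: card_image)
  have g: "(\<Sum>i\<in>M_of K P. \<Sum>j\<in>N_set K i. weight K (i, j) * x (i, j))
      = (\<Sum>ij\<in>P. group_load K x (fst ij))"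
    by (simp add: M sum.reindex[OF inj] group_load_def)
  have "(\<Sum>ij\<in>?Q. ?r * x ij) = (real (card ?Q) - 1) * ?r + ?r * (1 - (\<Sum>ij\<in>?Q. 1 - x ij))"
    by (simp add: sum_subtractf sum_distrib_left sum_distrib_right algebra_simps)
  then show ?thesis
    unfolding first_pack_ineq_def Let_def Q c g by linarith
qed

section \<open>Violated packs at a fixed point\<close>

locale ckp_point =
  fixes K :: ckp and x :: "nat \<times> nat \<Rightarrow> real" and ord :: "nat \<Rightarrow> nat list"
  assumes inst: "ckp_instance K"
    and box: "in_unit_box K x"
    and knap: "knapsack_constraint K x"
    and clique: "clique_inequalities K x"
    and ordering: "valid_orderings K x ord"
begin

abbreviation deficit :: "(nat \<times> nat) set \<Rightarrow> real" where
  "deficit Q \<equiv> (\<Sum>ij\<in>Q. 1 - x ij)"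

lemma weight_nonneg: "ij \<in> I_set K \<Longrightarrow> 0 \<le> weight K ij"
  using inst by (auto simp: ckp_instance_def)

lemma x_nonneg: "ij \<in> I_set K \<Longrightarrow> 0 \<le> x ij"
  and x_le_1: "ij \<in> I_set K \<Longrightarrow> x ij \<le> 1"
  using box by (auto simp: in_unit_box_def)

lemma deficit_mono:
  assumes "A \<subseteq> B" and "B \<subseteq> I_set K"
  shows "deficit A \<le> deficit B"
  using assms x_le_1 finite_subset[OF assms(2) finite_I_set]
  by (intro sum_mono2) auto

lemma pack_subset:
  assumes "pack K P" and "R \<subseteq> P"
  shows "pack K R"
proof -
  have "pack_weight K R \<le> pack_weight K P"
    using assms pack_finite[OF assms(1)] weight_nonneg
    unfolding pack_weight_def pack_def by (intro sum_mono2) auto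
  with assms show ?thesis by (auto simp: pack_def intro: inj_on_subset)
qed

lemma sum_group_load_le_capacity:
  assumes "pack K P"
  shows "(\<Sum>ij\<in>P. group_load K x (fst ij)) \<le> capacity K"
proof -
  have inj: "inj_on fst P" and sub: "fst ` P \<subseteq> M_set K"
    using assms by (auto simp: pack_def I_set_def)
  have "(\<Sum>ij\<in>P. group_load K x (fst ij)) = (\<Sum>i\<in>fst ` P. group_load K x i)"
    by (simp add: sum.reindex[OF inj])
  also have "\<dots> \<le> (\<Sum>i\<in>M_set K. group_load K x i)"
    using sub weight_nonneg x_nonneg
    by (intro sum_mono2) (auto simp: M_set_def group_load_def I_set_def intro!: sum_nonneg)
  also have "\<dots> = (\<Sum>ij\<in>I_set K. weight K ij * x ij)"
    unfolding group_load_def I_set_def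
    by (subst sum.Sigma) (auto simp: M_set_def N_set_def)
  also have "\<dots> \<le> capacity K" using knap by (simp add: knapsack_constraint_def)
  finally show ?thesis .
qed

lemma violated_deficit_less_1:
  assumes "pack K P" and "\<not> first_pack_ineq K P x"
  shows "deficit (nontrivial_part K P) < 1"
proof -
  have "0 < (capacity K - pack_weight K P) * (1 - deficit (nontrivial_part K P))"
    using assms sum_group_load_le_capacity[OF assms(1)]
    by (simp add: first_pack_ineq_alt)
  moreover have "0 < capacity K - pack_weight K P" using assms by (simp add: pack_def)
  ultimately show ?thesis by (simp add: zero_less_mult_iff)
qed

lemma group_load_trivial:
  assumes "ij \<in> I_set K" and "fst ij \<in> M0_set K"
  shows "group_load K x (fst ij) = weight K ij * x ij"
  using assms by (cases ij) (auto simp: group_load_def I_set_def M0_set_def N_set_def)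

text \<open>With trivial groups only, the deficit is 0 and each group load is at most the weight of
  its pair, so the left-hand side is at most \<open>s + (b - s) = b\<close>. This guarantees a pair
  that can play the role of \<open>(i', j')\<close>.\<close>

lemma violated_nontrivial_part_nonempty:
  assumes "pack K P" and "\<not> first_pack_ineq K P x"
  shows "nontrivial_part K P \<noteq> {}"
proof
  assume empty: "nontrivial_part K P = {}"
  have "group_load K x (fst ij) \<le> weight K ij" if "ij \<in> P" for ij
  proof -
    have "ij \<in> I_set K" using that assms(1) by (auto simp: pack_def)
    moreover have "fst ij \<in> M0_set K" using that empty unfolding nontrivial_part_def by blast
    ultimately show ?thesis
      using weight_nonneg x_le_1 by (simp add: group_load_trivial mult_left_le)
  qed
  then have "(\<Sum>ij\<in>P. group_load K x (fst ij)) \<le> pack_weight K P"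
    unfolding pack_weight_def by (rule sum_mono)
  with assms(2) show False by (simp add: first_pack_ineq_alt[OF assms(1)] empty)
qed

lemma violated_drop_small_trivial:
  assumes P: "pack K P" "\<not> first_pack_ineq K P x"
    and R: "nontrivial_part K P \<subseteq> R" "R \<subseteq> P"
    and small: "\<And>ij. ij \<in> P - R \<Longrightarrow> x ij \<le> 1 - deficit (nontrivial_part K P)"
  shows "\<not> first_pack_ineq K R x"
proof -
  let ?D = "1 - deficit (nontrivial_part K P)"
  let ?g = "\<lambda>ij. group_load K x (fst ij)"
  have fin: "finite P" by (rule pack_finite[OF P(1)])
  \<comment> \<open>\<open>R\<close> and \<open>P\<close> differ in trivial groups only, so the
    factor \<open>?D\<close> is the same for both packs.\<close>
  have Q: "nontrivial_part K R = nontrivial_part K P"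
    using R by (auto simp: nontrivial_part_def)
  have le: "?g ij \<le> weight K ij * ?D" if "ij \<in> P - R" for ij
  proof -
    have I: "ij \<in> I_set K" using that P(1) by (auto simp: pack_def)
    have "fst ij \<in> M0_set K" using that R by (auto simp: nontrivial_part_def)
    with I show ?thesis
      using small[OF that] weight_nonneg by (simp add: group_load_trivial mult_left_mono)
  qed
  have "(\<Sum>ij\<in>P - R. ?g ij) \<le> (\<Sum>ij\<in>P - R. weight K ij) * ?D"
    using sum_mono[of "P - R", OF le] by (simp add: sum_distrib_right)
  moreover have "(\<Sum>ij\<in>P. ?g ij) = (\<Sum>ij\<in>P - R. ?g ij) + (\<Sum>ij\<in>R. ?g ij)"
    by (rule sum.subset_diff[OF R(2) fin])
  moreover have "pack_weight K P = (\<Sum>ij\<in>P - R. weight K ij) + pack_weight K R"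
    unfolding pack_weight_def by (rule sum.subset_diff[OF R(2) fin])
  moreover have "capacity K < (\<Sum>ij\<in>P. ?g ij) + (capacity K - pack_weight K P) * ?D"
    using P by (simp add: first_pack_ineq_alt)
  ultimately have "capacity K < (\<Sum>ij\<in>R. ?g ij) + (capacity K - pack_weight K R) * ?D"
    by (simp add: algebra_simps)
  then show ?thesis
    by (simp add: first_pack_ineq_alt[OF pack_subset[OF P(1) R(2)]] Q)
qed

section \<open>Orderings of the nontrivial groups and base sets\<close>

context
  fixes i assumes i: "i \<in> M_set K - M0_set K"
begin

lemma set_ord: "set (ord i) = N_set K i"
  and sorted_ord: "sorted_wrt (\<lambda>j j'. x (i, j) \<ge> x (i, j')) (ord i)"
  using i ordering by (auto simp: valid_orderings_def)

lemma ord_neq_Nil: "ord i \<noteq> []"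
proof -
  have "1 \<in> N_set K i" using i inst by (simp add: ckp_instance_def N_set_def)
  then show ?thesis unfolding set_ord[symmetric] by (metis empty_iff empty_set)
qed

lemma hd_ord_in: "hd (ord i) \<in> N_set K i"
  unfolding set_ord[symmetric] using ord_neq_Nil by (rule hd_in_set)

lemma x_le_hd_ord:
  assumes "j \<in> N_set K i"
  shows "x (i, j) \<le> x (i, hd (ord i))"
proof (cases "ord i")
  case Nil
  then show ?thesis using ord_neq_Nil by contradiction
next
  case (Cons h t)
  have "j = h \<or> j \<in> set t" using assms[folded set_ord] unfolding Cons by simp
  then show ?thesis using sorted_ord unfolding Cons by auto
qed

text \<open>The value at the head of the ordering is at least as large, and by the clique inequality
  both values together are at most 1.\<close>

lemma x_le_half:
  assumes "j \<in> N_set K i" and "j \<noteq> hd (ord i)"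
  shows "x (i, j) \<le> 1 / 2"
proof -
  have "x (i, j) + x (i, hd (ord i)) = (\<Sum>l\<in>{j, hd (ord i)}. x (i, l))"
    using assms by simp
  also have "\<dots> \<le> (\<Sum>l\<in>N_set K i. x (i, l))"
    using assms i hd_ord_in x_nonneg by (intro sum_mono2) (auto simp: I_set_def N_set_def)
  also have "\<dots> \<le> 1" using clique i by (auto simp: clique_inequalities_def)
  finally show ?thesis using x_le_hd_ord[OF assms(1)] by simp
qed

end

text \<open>Each pair off the head of its ordering adds at least 1/2 to the deficit, so
  \<open>Q\<close> has at most one. Choosing it as \<open>(i', j')\<close> makes \<open>Q\<close> a
  set that the loops reach.\<close>

lemma small_deficit_eq_base_set:
  assumes "Q \<subseteq> I_set K" and "inj_on fst Q" and "fst ` Q \<inter> M0_set K = {}"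
    and "deficit Q < 1" and "Q \<noteq> {}"
  obtains i' j' where "(i', j') \<in> Q" and "Q = base_set ord (fst ` Q) i' j'"
proof -
  have group: "i \<in> M_set K - M0_set K" "j \<in> N_set K i" if "(i, j) \<in> Q" for i j
    using that assms(1,3) by (force simp: I_set_def)+
  have unique: "(i, j) = (k, l)"
    if ij: "(i, j) \<in> Q" "j \<noteq> hd (ord i)" and kl: "(k, l) \<in> Q" "l \<noteq> hd (ord k)" for i j k l
  proof (rule ccontr)
    assume "(i, j) \<noteq> (k, l)"
    then have "deficit {(i, j), (k, l)} = (1 - x (i, j)) + (1 - x (k, l))" by simp
    moreover have "deficit {(i, j), (k, l)} \<le> deficit Q"
      using ij kl assms(1) by (intro deficit_mono) auto
    moreover have "x (i, j) \<le> 1 / 2" "x (k, l) \<le> 1 / 2"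
      using ij kl group x_le_half by auto
    ultimately show False using assms(4) by simp
  qed
  obtain i' j' where m: "(i', j') \<in> Q"
    and others: "\<And>i j. (i, j) \<in> Q \<Longrightarrow> (i, j) \<noteq> (i', j') \<Longrightarrow> j = hd (ord i)"
  proof (cases "\<exists>i j. (i, j) \<in> Q \<and> j \<noteq> hd (ord i)")
    case True
    then show thesis using that unique by blast
  next
    \<comment> \<open>All pairs sit at the heads, so any element of the nonempty \<open>Q\<close>
      can serve as \<open>(i', j')\<close>.\<close>
    case False
    obtain i j where "(i, j) \<in> Q" using assms(5) by auto
    with False show thesis using that by blast
  qed
  \<comment> \<open>Injectivity of \<open>fst\<close> leaves no second pair in group
    \<open>i'\<close>, matching the removal of \<open>i'\<close> in \<open>base_set\<close>.\<close>
  have neq: "i \<noteq> i'" if "(i, j) \<in> Q" "(i, j) \<noteq> (i', j')" for i j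
    using that inj_onD[OF assms(2) _ that(1) m] by auto
  have "Q = base_set ord (fst ` Q) i' j'"
  proof
    show "Q \<subseteq> base_set ord (fst ` Q) i' j'"
    proof
      fix ij assume ij: "ij \<in> Q"
      show "ij \<in> base_set ord (fst ` Q) i' j'"
      proof (cases "ij = (i', j')")
        case False
        obtain i j where eq: "ij = (i, j)" by (cases ij)
        have mem: "(i, j) \<in> Q" and ne: "(i, j) \<noteq> (i', j')"
          using ij False unfolding eq by blast+
        have "i \<in> fst ` Q - {i'}"
          using mem neq[OF mem ne] image_eqI[of i fst "(i, j)" Q] by simp
        then show ?thesis
          unfolding eq others[OF mem ne] base_set_def by blast
      qed (simp add: base_set_def)
    qed
    show "base_set ord (fst ` Q) i' j' \<subseteq> Q"
    proof
      fix ij assume ij: "ij \<in> base_set ord (fst ` Q) i' j'"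
      show "ij \<in> Q"
      proof (cases "ij = (i', j')")
        case True
        with m show ?thesis by simp
      next
        case False
        then obtain i where i: "i \<in> fst ` Q" "i \<noteq> i'" and eq: "ij = (i, hd (ord i))"
          using ij unfolding base_set_def by blast
        obtain j where mem: "(i, j) \<in> Q" using i(1) by auto
        have "(i, j) \<noteq> (i', j')" using i(2) by simp
        from others[OF mem this] show ?thesis using mem by (simp only: eq)
      qed
    qed
  qed
  with m that show thesis by blast
qed

text \<open>The pair \<open>(i', j')\<close> lies outside the image because \<open>i'\<close> is
  removed there. Only the first summand depends on \<open>j'\<close>, so base sets for different
  \<open>j'\<close> are easy to compare.\<close>

lemma deficit_base_set:
  assumes "finite Mb"
  shows "deficit (base_set ord Mb i' j')
    = (1 - x (i', j')) + (\<Sum>i\<in>Mb - {i'}. 1 - x (i, hd (ord i)))"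
proof -
  have "deficit (base_set ord Mb i' j') =
      (1 - x (i', j')) + deficit ((\<lambda>i. (i, hd (ord i))) ` (Mb - {i'}))"
    using assms unfolding base_set_def by (simp add: image_iff)
  also have "deficit ((\<lambda>i. (i, hd (ord i))) ` (Mb - {i'}))
      = (\<Sum>i\<in>Mb - {i'}. 1 - x (i, hd (ord i)))"
    by (subst sum.reindex) (auto simp: inj_on_def)
  finally show ?thesis .
qed

section \<open>Soundness and completeness of the algorithm\<close>

lemma algorithm_A_sound:
  assumes "algorithm_A K x ord eM eI eP = Some P"
  shows "pack K P \<and> \<not> first_pack_ineq K P x"
  using assms unfolding algorithm_A_def Let_def
  by (auto dest!: for_loop_SomeD simp: Let_def split: if_splits)

text \<open>An earlier iteration may return a different pack, so \<open>R\<close> need not come from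
  \<open>P\<close>. It suffices to exhibit one iteration that returns and that no test cuts
  off.\<close>

lemma algorithm_A_complete:
  assumes enum: "valid_enumerations K x ord eM eI eP"
    and P: "pack K P" "\<not> first_pack_ineq K P x"
  shows "\<exists>R. algorithm_A K x ord eM eI eP = Some R"
proof -
  define Q where "Q = nontrivial_part K P"
  define Mb where "Mb = fst ` Q"
  have QP: "Q \<subseteq> P" by (auto simp: Q_def nontrivial_part_def)
  have QI: "Q \<subseteq> I_set K" using QP P(1) by (auto simp: pack_def)
  have packQ: "pack K Q" by (rule pack_subset[OF P(1) QP])
  have D: "deficit Q < 1" unfolding Q_def by (rule violated_deficit_less_1[OF P])
  have M0: "Mb \<inter> M0_set K = {}" by (auto simp: Mb_def Q_def nontrivial_part_def)
  have finM: "finite Mb" unfolding Mb_def using packQ pack_finite by blast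
  obtain i' j' where m: "(i', j') \<in> Q" and base: "Q = base_set ord Mb i' j'"
    using small_deficit_eq_base_set[OF QI _ _ D] packQ M0 violated_nontrivial_part_nonempty[OF P]
    unfolding Mb_def Q_def pack_def by metis
  have i'Mb: "i' \<in> Mb" using m unfolding Mb_def by force
  have group: "i \<in> M_set K - M0_set K" if "i \<in> Mb" for i
    using that M0 QI by (auto simp: Mb_def I_set_def)
  have j'N: "j' \<in> N_set K i'" using m QI by (auto simp: I_set_def)

  \<comment> \<open>The terms of the deficit are nonnegative, so a single pair of value 0 would
    already bring it to 1.\<close>
  have active: "Mb \<subseteq> active_groups K x ord"
  proof
    fix i assume i: "i \<in> Mb"
    then obtain j where j: "(i, j) \<in> Q" by (auto simp: Mb_def)
    then have "deficit {(i, j)} \<le> deficit Q" using QI by (intro deficit_mono) auto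
    with D have "0 < x (i, j)" by simp
    also have "\<dots> \<le> x (i, hd (ord i))"
      using j QI by (intro x_le_hd_ord[OF group[OF i]]) (auto simp: I_set_def)
    finally show "i \<in> active_groups K x ord" using group[OF i] by (simp add: active_groups_def)
  qed

  \<comment> \<open>Replacing \<open>j'\<close> by the head of \<open>ord i'\<close> can only lower
    the deficit, so \<open>Mb\<close> is not skipped.\<close>
  have "(\<Sum>i\<in>Mb. 1 - x (i, hd (ord i)))
      = (1 - x (i', hd (ord i'))) + (\<Sum>i\<in>Mb - {i'}. 1 - x (i, hd (ord i)))"
    by (rule sum.remove[OF finM i'Mb])
  also have "\<dots> \<le> deficit Q"
    using x_le_hd_ord[OF group[OF i'Mb] j'N] by (simp add: base deficit_base_set[OF finM])
  finally have first: "\<not> (\<Sum>i\<in>Mb. 1 - x (i, hd (ord i))) \<ge> 1" using D by simp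

  define P0 where "P0 = P \<inter> extension_candidates K x Q"
  have trivial_pair: "ij = (fst ij, 1)" if "ij \<in> P" "fst ij \<in> M0_set K" for ij
    using that P(1) by (cases ij) (auto simp: pack_def I_set_def M0_set_def N_set_def)
  have R: "pack K (Q \<union> P0)" "\<not> first_pack_ineq K (Q \<union> P0) x"
  proof -
    show "pack K (Q \<union> P0)" using QP by (intro pack_subset[OF P(1)]) (auto simp: P0_def)
    show "\<not> first_pack_ineq K (Q \<union> P0) x"
    proof (rule violated_drop_small_trivial[OF P])
      fix ij assume ij: "ij \<in> P - (Q \<union> P0)"
      then have "fst ij \<in> M0_set K" by (auto simp: Q_def nontrivial_part_def)
      with ij trivial_pair[of ij] show "x ij \<le> 1 - deficit (nontrivial_part K P)"
        by (cases ij) (auto simp: P0_def extension_candidates_def Q_def)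
    qed (use QP in \<open>auto simp: P0_def Q_def\<close>)
  qed
  have eP: "P0 \<in> set (eP Mb i' j')"
    using enum active i'Mb j'N base
    by (auto simp: valid_enumerations_def enumerates_def P0_def)

  \<comment> \<open>The loop over \<open>j'\<close> is the only one that can break, so the entries
    ahead of \<open>j'\<close> have to be examined. Their values are at least
    \<open>x (i', j')\<close>, hence their base sets have deficit at most
    \<open>deficit Q\<close>.\<close>
  obtain ys zs where split: "ord i' = ys @ j' # zs"
    using j'N set_ord[OF group[OF i'Mb]] by (metis split_list)
  have before: "\<not> deficit (base_set ord Mb i' j) \<ge> 1" if "j \<in> set ys" for j
  proof -
    have "x (i', j') \<le> x (i', j)"
      using that sorted_ord[OF group[OF i'Mb]] by (auto simp: split sorted_wrt_append)
    then have "deficit (base_set ord Mb i' j) \<le> deficit Q"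
      by (simp add: base deficit_base_set[OF finM])
    with D show ?thesis by simp
  qed

  \<comment> \<open>Naming the loop bodies lets the return be carried outwards one loop at a
    time.\<close>
  define body_P where "body_P = (\<lambda>Mb i' j' P0. let P = base_set ord Mb i' j' \<union> P0 in
    if pack K P \<and> \<not> first_pack_ineq K P x then Return P else Next)"
  define body_j where "body_j = (\<lambda>Mb i' j'. let Pb = base_set ord Mb i' j' in
    if deficit Pb \<ge> 1 then Break
    else if \<not> pack K Pb then Next
    else inner_loop (for_loop (eP Mb i' j') (body_P Mb i' j')))"
  define body_i where "body_i = (\<lambda>Mb i'. inner_loop (for_loop (ord i') (body_j Mb i')))"
  define body_M where "body_M = (\<lambda>Mb. if (\<Sum>i\<in>Mb. 1 - x (i, hd (ord i))) \<ge> 1 then Next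
    else inner_loop (for_loop (eI Mb) (body_i Mb)))"
  have A: "algorithm_A K x ord eM eI eP = for_loop eM body_M"
    unfolding algorithm_A_def body_M_def body_i_def body_j_def body_P_def Let_def ..

  have "body_P Mb i' j' P0 = Return (Q \<union> P0)"
    using R by (simp add: body_P_def base)
  then have "\<exists>r. for_loop (eP Mb i' j') (body_P Mb i' j') = Some r"
    by (rule for_loop_returns_no_break[OF eP]) (simp add: body_P_def Let_def)
  then obtain r1 where "body_j Mb i' j' = Return r1"
    using D packQ by (auto simp: body_j_def base[symmetric])
  then have "\<exists>r. for_loop (ord i') (body_j Mb i') = Some r"
    unfolding split using before
    by (intro for_loop_returns[where body = "body_j Mb i'"]) (simp_all add: body_j_def Let_def)
  then obtain r2 where ret_i: "body_i Mb i' = Return r2"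
    by (auto simp: body_i_def)
  have "i' \<in> set (eI Mb)"
    using enum active i'Mb by (auto simp: valid_enumerations_def enumerates_def)
  from for_loop_returns_no_break[where body = "body_i Mb", OF this ret_i]
  have "\<exists>r. for_loop (eI Mb) (body_i Mb) = Some r"
    by (simp add: body_i_def)
  then obtain r3 where ret_M: "body_M Mb = Return r3"
    using first by (auto simp: body_M_def)
  have "Mb \<in> set eM"
    using enum active by (auto simp: valid_enumerations_def enumerates_def)
  from for_loop_returns_no_break[where body = body_M, OF this ret_M]
  show ?thesis
    unfolding A by (simp add: body_M_def)
qed

end

theorem theorem8:
  fixes K :: ckp
    and x :: "nat \<times> nat \<Rightarrow> real"
    and ord :: "nat \<Rightarrow> nat list"
    and eM :: "nat set list"
    and eI :: "nat set \<Rightarrow> nat list"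
    and eP :: "nat set \<Rightarrow> nat \<Rightarrow> nat \<Rightarrow> (nat \<times> nat) set list"
  assumes "ckp_instance K"
    and "in_unit_box K x"
    and "knapsack_constraint K x"
    and "clique_inequalities K x"
    and "\<not> complementarity_constraints K x"
    and "valid_orderings K x ord"
    and "valid_enumerations K x ord eM eI eP"
  shows "((\<exists>P. pack K P \<and> \<not> first_pack_ineq K P x) \<longrightarrow>
           (\<exists>P. algorithm_A K x ord eM eI eP = Some P \<and> pack K P \<and> \<not> first_pack_ineq K P x)) \<and>
         (\<not> (\<exists>P. pack K P \<and> \<not> first_pack_ineq K P x) \<longrightarrow>
           algorithm_A K x ord eM eI eP = None)"
proof -
  interpret ckp_point K x ord
    by unfold_locales (use assms in auto)
  \<comment> \<open>Soundness forces \<open>None\<close> when no pack is violated; completeness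
    excludes \<open>None\<close> otherwise.\<close>
  show ?thesis
    using algorithm_A_sound[of eM eI eP] algorithm_A_complete[OF assms(7)]
    by (cases "algorithm_A K x ord eM eI eP") auto
qed

end
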